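(* Let $\mathcal{K}_{3,4}\subset\mathbb{R}^{15}$ be the convex cone of non-negative ternary quartics. Then $\mathcal{K}_{3,4}$ is not a spectrahedron. Its facets have dimension twelve, and the intersection of any two distinct facets is an exposed face of dimension nine. It also has maximal non-exposed faces of dimension nine.
   Context: A ternary quartic is a real homogeneous polynomial of degree $4$ in three variables; these form a $15$-dimensional real vector space. $\mathcal{K}_{3,4}$ is the set of those that take only non-negative values on $\mathbb{R}^3$ (it coincides with the cone of sums of squares of quadratic forms and is dual to the cone over the Veronese orbitope $\mathrm{conv}(\nu_4(\mathbb{S}^2))$). A face of a closed convex set $K$ is a closed convex subset $F\subseteq K$ containing the two endpoints of every open segment in $K$ that it intersects. A face is exposed if it is the set of points of $K$ at which some linear functional attains its maximum (or minimum) over $K$. A facet is an inclusion-maximal proper face. "Maximal non-exposed face" means a non-exposed face that is maximal under inclusion among non-exposed faces. A spectrahedron is a set of the form $\{x\in\mathbb{R}^N:A_0+x_1A_1+\cdots+x_NA_N\succeq0\}$ with $A_i$ real symmetric matrices. *)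

theory Defs
  imports "HOL-Analysis.Analysis"
begin

text \<open>
  A ternary quartic is given by its coefficient vector, indexed by the exponents \<open>(i, j, k)\<close> of
  the monomials \<open>x\<^sup>i y\<^sup>j z\<^sup>k\<close> of degree 4. Thus \<^typ>\<open>real ^ 'n\<close> with this index type is the
  15-dimensional space of ternary quartics; see \<open>dim_quartics\<close>.
\<close>

typedef quartic_monom = "{(i :: nat, j :: nat, k :: nat). i + j + k = 4}"
  morphisms exponents quartic_monom_of
  by (rule exI[of _ "(4, 0, 0)"]) simp

lemma exponents_set_eq:
  "{(i :: nat, j :: nat, k :: nat). i + j + k = 4}
     = (\<lambda>(i, j). (i, j, 4 - i - j)) ` (SIGMA i:{..4}. {..4 - i})"
  by (force simp: image_iff)

instance quartic_monom :: finite
proof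
  have "finite {(i :: nat, j :: nat, k :: nat). i + j + k = 4}"
    unfolding exponents_set_eq by simp
  then show "finite (UNIV :: quartic_monom set)"
    unfolding type_definition.univ[OF type_definition_quartic_monom] by (rule finite_imageI)
qed

type_synonym quartic = "real ^ quartic_monom"

lemma card_quartic_monom: "CARD(quartic_monom) = 15"
proof -
  have "CARD(quartic_monom) = card (SIGMA i:{..4::nat}. {..4 - i})"
    unfolding type_definition.card[OF type_definition_quartic_monom] exponents_set_eq
    by (rule card_image) (auto simp: inj_on_def)
  also have "\<dots> = 15"
    by (simp add: numeral_eq_Suc)
  finally show ?thesis .
qed

lemma dim_quartics: "DIM(quartic) = 15"
  by (simp add: card_quartic_monom)

definition quartic_eval :: "quartic \<Rightarrow> real ^ 3 \<Rightarrow> real" where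
  "quartic_eval f x =
     (\<Sum>m\<in>UNIV. f $ m * (case exponents m of (i, j, k) \<Rightarrow> (x $ 1) ^ i * (x $ 2) ^ j * (x $ 3) ^ k))"

definition nonneg_quartics :: "quartic set" where
  "nonneg_quartics = {f. \<forall>x. 0 \<le> quartic_eval f x}"

text \<open>
  The matrix size \<open>n\<close> is existentially quantified in the definition of a spectrahedron, so
  matrices are functions on indices, of which only the entries below \<open>n\<close> matter.
\<close>

definition symmetric_matrix :: "nat \<Rightarrow> (nat \<Rightarrow> nat \<Rightarrow> real) \<Rightarrow> bool" where
  "symmetric_matrix n M \<longleftrightarrow> (\<forall>i<n. \<forall>j<n. M i j = M j i)"

definition pos_semidef :: "nat \<Rightarrow> (nat \<Rightarrow> nat \<Rightarrow> real) \<Rightarrow> bool" where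
  "pos_semidef n M \<longleftrightarrow>
     symmetric_matrix n M \<and> (\<forall>v :: nat \<Rightarrow> real. 0 \<le> (\<Sum>i<n. \<Sum>j<n. v i * M i j * v j))"

definition is_spectrahedron :: "(real ^ 'd) set \<Rightarrow> bool" where
  "is_spectrahedron S \<longleftrightarrow>
     (\<exists>(n :: nat) (A0 :: nat \<Rightarrow> nat \<Rightarrow> real) (A :: 'd \<Rightarrow> nat \<Rightarrow> nat \<Rightarrow> real).
        symmetric_matrix n A0 \<and> (\<forall>m. symmetric_matrix n (A m)) \<and>
        S = {x. pos_semidef n (\<lambda>i j. A0 i j + (\<Sum>m\<in>UNIV. x $ m * A m i j))})"

text \<open>
  The library's \<open>facet_of\<close> means a face of codimension one, which is not the notion needed here.
  The library's \<open>face_of\<close> does not ask for closedness, but faces of closed convex sets in a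
  Euclidean space are closed (\<open>face_of_imp_closed\<close>).
\<close>

definition is_facet :: "'a::euclidean_space set \<Rightarrow> 'a set \<Rightarrow> bool" where
  "is_facet K F \<longleftrightarrow>
     F face_of K \<and> F \<noteq> K \<and> (\<forall>G. G face_of K \<and> G \<noteq> K \<and> F \<subseteq> G \<longrightarrow> G = F)"

definition nonexposed_face :: "'a::euclidean_space set \<Rightarrow> 'a set \<Rightarrow> bool" where
  "nonexposed_face K F \<longleftrightarrow> F face_of K \<and> \<not> F exposed_face_of K"

definition maximal_nonexposed_face :: "'a::euclidean_space set \<Rightarrow> 'a set \<Rightarrow> bool" where
  "maximal_nonexposed_face K F \<longleftrightarrow>
     nonexposed_face K F \<and> (\<forall>G. nonexposed_face K G \<and> F \<subseteq> G \<longrightarrow> G = F)"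

end

theory Submission
  imports Defs
begin

text \<open>
  Let \<open>K\<close> be the cone of non-negative ternary quartics. Everything rests on the zeros of
  quartics and on the second-order behaviour there.

  A quartic that is positive away from the origin dominates every other quartic up to a factor, so a face
  that contains one is all of \<open>K\<close>. Hence a proper face has a common zero \<open>p\<close>
  (\<open>proper_face_subset_vanishing\<close>), and the facets are among the sets of all quartics in \<open>K\<close>
  that vanish at a point \<open>p\<close>. These sets, and their intersections, are exposed by evaluations.
  A linear change of coordinates (\<open>aff_dim_vanishing_image\<close>) moves one or two points of the projective plane to
  coordinate points. A zero of a non-negative quartic is a critical point, which costs three
  coefficients: this leaves \<open>15 - 3 = 12\<close> dimensions for one zero and \<open>15 - 6 = 9\<close> for two. There
  are no further linear conditions, because squares of quadratic forms that vanish at these points belong to the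
  face, and by polarization the span contains the products of any two such forms
  (\<open>aff_dim_sparse_quartics\<close>).

  If the Hessian at \<open>p = (1, 0, 0)\<close> is moreover degenerate in the direction \<open>z\<close>, the coefficients of
  \<open>x\<^sup>2 z\<^sup>2\<close>, \<open>x\<^sup>2 y z\<close> and \<open>x z\<^sup>3\<close> vanish, so these quartics form a face of dimension \<open>12 - 3 = 9\<close>.
  It is not exposed, since \<open>(x\<^sup>2 + t z\<^sup>2)\<^sup>2\<close> for all real \<open>t\<close> forces a functional that supports \<open>K\<close> along this face to vanish
  at \<open>x\<^sup>2 z\<^sup>2\<close> as well. It is maximal with this property: together with any quartic of the facet at
  \<open>p\<close> whose \<open>x\<^sup>2 z\<^sup>2\<close> coefficient is positive it generates the whole facet
  (\<open>face_above_flat_face\<close>).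

  All faces of a spectrahedron are exposed, which already excludes \<open>K\<close>. The proof below carries this
  out on a plane section of \<open>K\<close>, where a ray and a parabola in the boundary meet tangentially
  (\<open>nonneg_quartics_not_spectrahedron\<close>); the step from kernels to matrix inequalities is
  \<open>pos_semidef_dominated\<close>.
\<close>

section \<open>Quartics as polynomial functions\<close>

abbreviation monomial_fun :: "nat \<times> nat \<times> nat \<Rightarrow> real ^ 3 \<Rightarrow> real" where
  "monomial_fun t x \<equiv> (case t of (i, j, k) \<Rightarrow> x $ 1 ^ i * x $ 2 ^ j * x $ 3 ^ k)"

text \<open>
  Coefficients and monomials are addressed by exponent triples. A triple whose entries do not add up
  to 4 is not in the domain of the type morphism, so it denotes an unspecified coefficient; all
  statements about coefficients are confined to the triples of degree 4.
\<close>

definition quartic_coeff :: "quartic \<Rightarrow> nat \<times> nat \<times> nat \<Rightarrow> real" where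
  "quartic_coeff f t = f $ quartic_monom_of t"

definition monomial :: "nat \<times> nat \<times> nat \<Rightarrow> quartic" where
  "monomial t = axis (quartic_monom_of t) 1"

lemma quartic_coeff_simps [simp]:
  "quartic_coeff 0 t = 0"
  "quartic_coeff (f + g) t = quartic_coeff f t + quartic_coeff g t"
  "quartic_coeff (f - g) t = quartic_coeff f t - quartic_coeff g t"
  "quartic_coeff (c *\<^sub>R f) t = c * quartic_coeff f t"
  by (simp_all add: quartic_coeff_def)

lemma quartic_monom_of_eq_iff:
  assumes "i + j + k = 4" "i' + j' + k' = 4"
  shows "quartic_monom_of (i, j, k) = quartic_monom_of (i', j', k') \<longleftrightarrow> (i, j, k) = (i', j', k')"
  by (rule quartic_monom_of_inject) (use assms in auto)

lemma quartic_coeff_monomial: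
  assumes "i + j + k = 4" "i' + j' + k' = 4"
  shows "quartic_coeff (monomial (i, j, k)) (i', j', k') = (if (i, j, k) = (i', j', k') then 1 else 0)"
  using quartic_monom_of_eq_iff[OF assms]
  by (auto simp: quartic_coeff_def monomial_def axis_def)

definition exponents4 :: "(nat \<times> nat \<times> nat) set" where
  "exponents4 = {(i, j, k). i + j + k = 4}"

lemma exponents4_explicit:
  "exponents4 = {(4,0,0), (3,1,0), (3,0,1), (2,2,0), (2,1,1), (2,0,2), (1,3,0), (1,2,1), (1,1,2),
     (1,0,3), (0,4,0), (0,3,1), (0,2,2), (0,1,3), (0,0,4)}" (is "_ = ?R")
proof -
  have "exponents4 \<subseteq> ?R"
  proof
    fix t assume "t \<in> exponents4"
    then obtain i j k where t: "t = (i, j, k)" and s: "i + j + k = 4" by (auto simp: exponents4_def)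
    then have i: "i = 0 \<or> i = 1 \<or> i = 2 \<or> i = 3 \<or> i = 4" and j: "j = 0 \<or> j = 1 \<or> j = 2 \<or> j = 3 \<or> j = 4"
      by arith+
    then show "t \<in> ?R" using s unfolding t by (elim disjE) simp_all
  qed
  then show ?thesis by (auto simp: exponents4_def)
qed

lemma bij_betw_quartic_monom_of: "bij_betw quartic_monom_of exponents4 UNIV"
  unfolding bij_betw_def exponents4_def
  by (auto simp: inj_on_def quartic_monom_of_inject type_definition.univ[OF type_definition_quartic_monom])

lemma quartic_eval_sum:
  "quartic_eval f x = (\<Sum>t\<in>exponents4. quartic_coeff f t * monomial_fun t x)"
proof -
  have "quartic_eval f x = (\<Sum>t\<in>exponents4. f $ quartic_monom_of t * monomial_fun (exponents (quartic_monom_of t)) x)"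
    unfolding quartic_eval_def by (rule sum.reindex_bij_betw[OF bij_betw_quartic_monom_of, symmetric])
  also have "\<dots> = (\<Sum>t\<in>exponents4. quartic_coeff f t * monomial_fun t x)"
    by (rule sum.cong) (auto simp: quartic_coeff_def exponents4_def quartic_monom_of_inverse)
  finally show ?thesis .
qed

lemma finite_exponents4: "finite exponents4"
  by (simp add: exponents4_explicit)

lemma quartic_eval_linear [simp]:
  "quartic_eval 0 x = 0"
  "quartic_eval (f + g) x = quartic_eval f x + quartic_eval g x"
  "quartic_eval (f - g) x = quartic_eval f x - quartic_eval g x"
  "quartic_eval (c *\<^sub>R f) x = c * quartic_eval f x"
  by (simp_all add: quartic_eval_sum algebra_simps sum.distrib sum_subtractf sum_distrib_left)

lemma quartic_eval_monomial:
  assumes "i + j + k = 4"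
  shows "quartic_eval (monomial (i, j, k)) x = x $ 1 ^ i * x $ 2 ^ j * x $ 3 ^ k"
proof -
  have "quartic_eval (monomial (i, j, k)) x
      = (\<Sum>t\<in>exponents4. if t = (i, j, k) then monomial_fun t x else 0)"
    unfolding quartic_eval_sum
    by (rule sum.cong) (use assms in \<open>auto simp: exponents4_def quartic_coeff_monomial split: if_splits\<close>)
  also have "\<dots> = monomial_fun (i, j, k) x"
    using assms finite_exponents4 by (simp add: exponents4_def)
  finally show ?thesis by simp
qed

lemma quartic_eval_explicit:
  "quartic_eval f x =
     quartic_coeff f (4,0,0) * x$1^4 + quartic_coeff f (3,1,0) * x$1^3 * x$2
   + quartic_coeff f (3,0,1) * x$1^3 * x$3 + quartic_coeff f (2,2,0) * x$1^2 * x$2^2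
   + quartic_coeff f (2,1,1) * x$1^2 * x$2 * x$3 + quartic_coeff f (2,0,2) * x$1^2 * x$3^2
   + quartic_coeff f (1,3,0) * x$1 * x$2^3 + quartic_coeff f (1,2,1) * x$1 * x$2^2 * x$3
   + quartic_coeff f (1,1,2) * x$1 * x$2 * x$3^2 + quartic_coeff f (1,0,3) * x$1 * x$3^3
   + quartic_coeff f (0,4,0) * x$2^4 + quartic_coeff f (0,3,1) * x$2^3 * x$3
   + quartic_coeff f (0,2,2) * x$2^2 * x$3^2 + quartic_coeff f (0,1,3) * x$2 * x$3^3
   + quartic_coeff f (0,0,4) * x$3^4"
  unfolding quartic_eval_sum exponents4_explicit by (simp add: algebra_simps)

lemma quartic_eqI:
  assumes "\<And>t. t \<in> exponents4 \<Longrightarrow> quartic_coeff f t = quartic_coeff g t"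
  shows "f = g"
  unfolding vec_eq_iff
proof
  fix m
  obtain t where "t \<in> exponents4" "m = quartic_monom_of t"
    using bij_betw_imp_surj_on[OF bij_betw_quartic_monom_of] by blast
  then show "f $ m = g $ m" using assms by (simp add: quartic_coeff_def)
qed

text \<open>
  A polynomial that vanishes as a function has no coefficients: Kronecker's substitution
  \<open>(x, y, z) = (t\<^sup>2\<^sup>5, t\<^sup>5, 1)\<close> separates the 15 monomials of degree 4, because the exponents
  \<open>25 i + 5 j\<close> with \<open>i, j \<le> 4\<close> are distinct, and leaves a univariate polynomial.
\<close>

lemma quartic_eval_eq_0:
  assumes "\<And>x. quartic_eval f x = 0"
  shows "f = 0"
proof (rule quartic_eqI)
  let ?e = "\<lambda>(i, j, k :: nat). 25 * i + 5 * j :: nat"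
  let ?c = "\<lambda>n. \<Sum>t | t \<in> exponents4 \<and> ?e t = n. quartic_coeff f t"
  have "(\<Sum>n\<le>100. ?c n * t ^ n) = 0" for t
  proof -
    have "(\<Sum>n\<le>100. ?c n * t ^ n) = (\<Sum>n\<le>100. \<Sum>u | u \<in> exponents4 \<and> ?e u = n. quartic_coeff f u * t ^ ?e u)"
      by (simp add: sum_distrib_right)
    also have "\<dots> = (\<Sum>u\<in>exponents4. quartic_coeff f u * t ^ ?e u)"
      by (rule sum.group) (auto simp: exponents4_explicit)
    also have "\<dots> = quartic_eval f (vector [t ^ 25, t ^ 5, 1])"
      unfolding quartic_eval_sum
      by (rule sum.cong) (auto simp: vector_3 power_mult power_add)
    finally show ?thesis by (simp add: assms)
  qed
  then have c: "?c n = 0" if "n \<le> 100" for n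
    using polyfun_eq_0[of ?c 100] that by simp
  fix t assume t: "t \<in> exponents4"
  have "u = t" if u: "u \<in> exponents4" "?e u = ?e t" for u
  proof -
    obtain i j k where e: "t = (i, j, k)" "i + j + k = 4" using t by (auto simp: exponents4_def)
    obtain i' j' k' where e': "u = (i', j', k')" "i' + j' + k' = 4"
      using u(1) by (auto simp: exponents4_def)
    have "5 * i' + j' = 5 * i + j" and "j < 5" "j' < 5" using u(2) e e' by simp_all
    then have "i' = i" "j' = j" by arith+
    then show ?thesis using e e' by simp
  qed
  then have "{u. u \<in> exponents4 \<and> ?e u = ?e t} = {t}" using t by blast
  moreover have "?e t \<le> 100" using t by (auto simp: exponents4_def)
  ultimately
  show "quartic_coeff f t = quartic_coeff 0 t" using c[of "?e t"] by simp
qed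

lemma quartic_eval_inject:
  assumes "\<And>x. quartic_eval f x = quartic_eval g x"
  shows "f = g"
  using quartic_eval_eq_0[of "f - g"] assms by simp

lemma quartic_eval_scale: "quartic_eval f (c *\<^sub>R x) = c ^ 4 * quartic_eval f x"
  unfolding quartic_eval_sum sum_distrib_left
  by (rule sum.cong) (auto simp: exponents4_def power_mult_distrib algebra_simps simp flip: power_add)

lemma continuous_on_quartic_eval: "continuous_on S (quartic_eval f)"
  unfolding quartic_eval_explicit[abs_def] by (intro continuous_intros)

section \<open>Linear changes of coordinates\<close>

text \<open>
  Composing a quartic with a linear map gives a quartic again, but its coefficients are unwieldy.
  They need not be written down: ternary forms, as functions, are closed under products,
  and a monomial composed with a linear map is a product of linear forms.
\<close>

inductive ternary_form :: "nat \<Rightarrow> (real ^ 3 \<Rightarrow> real) \<Rightarrow> bool" where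
  monom: "ternary_form (i + j + k) (\<lambda>x. c * (x $ 1 ^ i * x $ 2 ^ j * x $ 3 ^ k))"
| add: "ternary_form d f \<Longrightarrow> ternary_form d g \<Longrightarrow> ternary_form d (\<lambda>x. f x + g x)"

lemma ternary_form_4_imp_quartic: "ternary_form d f \<Longrightarrow> d = 4 \<Longrightarrow> \<exists>q. \<forall>x. quartic_eval q x = f x"
proof (induction rule: ternary_form.induct)
  case (monom i j k c)
  then show ?case by (intro exI[of _ "c *\<^sub>R monomial (i, j, k)"]) (simp add: quartic_eval_monomial)
next
  case (add d f g)
  then obtain p q where "\<forall>x. quartic_eval p x = f x" "\<forall>x. quartic_eval q x = g x" by blast
  then show ?case by (intro exI[of _ "p + q"]) simp
qed

lemma ternary_form_mult_monom:
  "ternary_form d f \<Longrightarrow> ternary_form (i + j + k + d) (\<lambda>x. c * (x $ 1 ^ i * x $ 2 ^ j * x $ 3 ^ k) * f x)"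
proof (induction rule: ternary_form.induct)
  case (monom i' j' k' c')
  show ?case using ternary_form.monom[of "i + i'" "j + j'" "k + k'" "c * c'"]
    by (simp add: power_add algebra_simps)
next
  case (add d f g)
  then show ?case using ternary_form.add by (fastforce simp: distrib_left)
qed

lemma ternary_form_mult:
  "ternary_form d f \<Longrightarrow> ternary_form e g \<Longrightarrow> ternary_form (d + e) (\<lambda>x. f x * g x)"
proof (induction rule: ternary_form.induct)
  case (monom i j k c)
  then show ?case by (rule ternary_form_mult_monom)
next
  case (add d f g)
  then show ?case using ternary_form.add by (fastforce simp: distrib_right)
qed

lemma ternary_form_power: "ternary_form 1 f \<Longrightarrow> ternary_form n (\<lambda>x. f x ^ n)"
proof (induction n)
  case 0
  then show ?case using ternary_form.monom[of 0 0 0 1] by simp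
next
  case (Suc n)
  then show ?case using ternary_form_mult[of 1 f n] by simp
qed

lemma ternary_form_linear:
  assumes "linear f"
  shows "ternary_form 1 (\<lambda>x. f x :: real)"
proof -
  have "f x = f (axis 1 1) * x $ 1 + f (axis 2 1) * x $ 2 + f (axis 3 1) * x $ 3" for x
  proof -
    have "x = x $ 1 *\<^sub>R axis 1 1 + x $ 2 *\<^sub>R axis 2 1 + x $ 3 *\<^sub>R axis 3 1"
      by (simp add: vec_eq_iff forall_3 axis_def)
    then have "f x = f (x $ 1 *\<^sub>R axis 1 1 + x $ 2 *\<^sub>R axis 2 1 + x $ 3 *\<^sub>R axis 3 1)" by simp
    then show ?thesis using assms by (simp add: linear_add linear_scale algebra_simps)
  qed
  then have f: "f = (\<lambda>x. f (axis 1 1) * x $ 1 + f (axis 2 1) * x $ 2 + f (axis 3 1) * x $ 3)" by blast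
  have "ternary_form 1 (\<lambda>x. c * x $ 1)" "ternary_form 1 (\<lambda>x. c * x $ 2)"
      "ternary_form 1 (\<lambda>x. c * x $ 3)" for c
    using ternary_form.monom[of 1 0 0 c] ternary_form.monom[of 0 1 0 c] ternary_form.monom[of 0 0 1 c]
    by simp_all
  from ternary_form.add[OF ternary_form.add[OF this(1,2)] this(3)] show ?thesis
    by (subst f)
qed

lemma ternary_form_compose_linear:
  assumes "ternary_form d f" "linear A"
  shows "ternary_form d (\<lambda>x. f (A x))"
  using assms(1)
proof induction
  case (monom i j k c)
  have l: "ternary_form 1 (\<lambda>x. A x $ i)" for i
    using assms(2) by (intro ternary_form_linear) (simp add: linear_iff)
  have "ternary_form (i + j + k) (\<lambda>x. A x $ 1 ^ i * A x $ 2 ^ j * A x $ 3 ^ k)"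
    by (intro ternary_form_mult ternary_form_power l)
  then show ?case using ternary_form_mult_monom[of "i + j + k" _ 0 0 0 c] by simp
next
  case (add d f g)
  then show ?case using ternary_form.add by blast
qed

lemma ternary_form_quartic: "ternary_form 4 (quartic_eval f)"
proof -
  note a = ternary_form.add and m = ternary_form.monom
  have "ternary_form 4 (\<lambda>x. \<Sum>t\<in>S. quartic_coeff f t * monomial_fun t x)"
    if "finite S" "S \<subseteq> exponents4" for S
    using that
  proof (induction S)
    case empty
    then show ?case using m[of 4 0 0 0] by simp
  next
    case (insert t S)
    obtain i j k where t: "t = (i, j, k)" by (cases t)
    then have "i + j + k = 4" using insert by (auto simp: exponents4_def)
    then have "ternary_form 4 (\<lambda>x. quartic_coeff f t * monomial_fun t x)"
      using m[of i j k] t by simp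
    then show ?case using a insert by fastforce
  qed
  then show ?thesis unfolding quartic_eval_sum[abs_def] using finite_exponents4 by simp
qed

text \<open>
  The quartic exists by the preceding closure properties and is unique because a quartic is
  determined by its values.
\<close>

definition pullback :: "(real ^ 3 \<Rightarrow> real ^ 3) \<Rightarrow> quartic \<Rightarrow> quartic" where
  "pullback A f = (SOME g. \<forall>x. quartic_eval g x = quartic_eval f (A x))"

lemma quartic_eval_pullback:
  assumes "linear A"
  shows "quartic_eval (pullback A f) x = quartic_eval f (A x)"
  unfolding pullback_def
  using someI_ex[OF ternary_form_4_imp_quartic[OF ternary_form_compose_linear[OF ternary_form_quartic[of f] assms] refl]]
  by blast

lemma linear_pullback:
  assumes "linear A"
  shows "linear (pullback A)"
  by (rule linearI; rule quartic_eval_inject) (simp_all add: quartic_eval_pullback[OF assms])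

lemma pullback_pullback:
  assumes "linear A" "linear B" "\<And>x. A (B x) = x"
  shows "pullback B (pullback A f) = f"
  by (rule quartic_eval_inject) (simp add: quartic_eval_pullback assms)

section \<open>Faces of convex cones\<close>

lemma nonneg_quartics_iff: "f \<in> nonneg_quartics \<longleftrightarrow> (\<forall>x. 0 \<le> quartic_eval f x)"
  by (simp add: nonneg_quartics_def)

lemma cone_nonneg_quartics: "cone nonneg_quartics"
  by (simp add: nonneg_quartics_iff cone_def)

lemma convex_nonneg_quartics: "convex nonneg_quartics"
  by (simp add: nonneg_quartics_iff convex_def)

text \<open>
  The point \<open>f \<noteq> 0\<close> lies on the open segment from \<open>0\<close> to a large multiple of \<open>f\<close>, so the face
  contains both ends of it.
\<close>

lemma scale_mem_face_of_cone:
  fixes K :: "'a::euclidean_space set"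
  assumes "cone K" "F face_of K" "f \<in> F" "0 \<le> c"
  shows "c *\<^sub>R f \<in> F"
proof (cases "f = 0")
  case False
  define t where "t = c + 2"
  have t: "t > 1" "c \<le> t" using assms(4) by (auto simp: t_def)
  have K: "0 \<in> K" "t *\<^sub>R f \<in> K"
    using assms face_of_imp_subset[of F K] t unfolding cone_def by (metis scaleR_zero_left order_refl subsetD, force)
  have "f \<in> open_segment 0 (t *\<^sub>R f)"
    using False t by (auto simp: in_segment intro!: exI[of _ "1 / t"])
  then have "0 \<in> F" "t *\<^sub>R f \<in> F"
    using face_ofD[OF assms(2) _ K] assms(3) by auto
  then have "(1 - c / t) *\<^sub>R 0 + (c / t) *\<^sub>R (t *\<^sub>R f) \<in> F"
    using face_of_imp_convex[OF assms(2)] t assms(4) unfolding convex_alt by (meson divide_le_eq_1_pos divide_nonneg_pos dual_order.trans less_eq_real_def zero_less_one order_less_trans)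
  then show ?thesis using t by simp
qed (use assms in simp)

lemma add_mem_face_of_cone:
  fixes K :: "'a::euclidean_space set"
  assumes "cone K" "F face_of K" "f \<in> F" "g \<in> F"
  shows "f + g \<in> F"
proof -
  have "(1/2) *\<^sub>R f + (1/2) *\<^sub>R g \<in> F"
    using face_of_imp_convex[OF assms(2)] assms(3,4) by (intro convexD) auto
  from scale_mem_face_of_cone[OF assms(1,2) this, of 2] show ?thesis
    by (simp add: scaleR_add_right)
qed

text \<open>
  This criterion produces members of a face: \<open>f\<close> is the midpoint of \<open>2 e g\<close> and \<open>2 (f - e g)\<close>, both of which lie
  in the cone.
\<close>

lemma dominated_mem_face_of_cone:
  fixes K :: "'a::euclidean_space set"
  assumes "cone K" "F face_of K" "f \<in> F" "g \<in> K" "e > 0" "f - e *\<^sub>R g \<in> K"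
  shows "g \<in> F"
proof -
  let ?a = "(2 * e) *\<^sub>R g" and ?b = "2 *\<^sub>R (f - e *\<^sub>R g)"
  have K: "?a \<in> K" "?b \<in> K" using assms unfolding cone_def by auto
  have mid: "f = (1 - 1/2) *\<^sub>R ?a + (1/2) *\<^sub>R ?b" by (simp add: algebra_simps)
  have "?a \<in> F"
  proof (cases "?a = ?b")
    case True
    have "f = (1 - 1/2) *\<^sub>R ?a + (1/2) *\<^sub>R ?a" by (subst (2) True) (rule mid)
    also have "\<dots> = ?a" by (simp flip: scaleR_add_left)
    finally have "f = ?a" .
    then show ?thesis using assms(3) by simp
  next
    case False
    then have "f \<in> open_segment ?a ?b" unfolding in_segment using mid by (auto intro!: exI[of _ "1/2"])
    then show ?thesis using face_ofD[OF assms(2) _ K] assms(3) by blast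
  qed
  from scale_mem_face_of_cone[OF assms(1,2) this, of "1 / (2 * e)"] assms(5) show ?thesis by simp
qed

section \<open>Proper faces and zeros\<close>

text \<open>
  Evaluation at a point is the inner product with the image of that point on the Veronese cone,
  so it provides the supporting hyperplanes that expose the sets of quartics vanishing at a point.
\<close>

definition veronese :: "real ^ 3 \<Rightarrow> quartic" where
  "veronese x = (\<chi> m. monomial_fun (exponents m) x)"

lemma quartic_eval_eq_inner: "quartic_eval f x = veronese x \<bullet> f"
  unfolding quartic_eval_def veronese_def inner_vec_def by (simp add: mult.commute)

definition vanishing :: "(real ^ 3) set \<Rightarrow> quartic set" where
  "vanishing P = {f \<in> nonneg_quartics. \<forall>p\<in>P. quartic_eval f p = 0}"

lemma vanishing_exposed_face: "vanishing {p} exposed_face_of nonneg_quartics"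
proof -
  have "vanishing {p} = nonneg_quartics \<inter> {f. veronese p \<bullet> f = 0}"
    by (auto simp: vanishing_def quartic_eval_eq_inner)
  then show ?thesis
    using exposed_face_of_Int_supporting_hyperplane_ge[OF convex_nonneg_quartics, of 0 "veronese p"]
    by (simp add: nonneg_quartics_iff quartic_eval_eq_inner)
qed

lemma vanishing_insert: "vanishing {p} \<inter> vanishing {q} = vanishing {p, q}"
  by (auto simp: vanishing_def)

lemma vanishing_face: "vanishing {p} face_of nonneg_quartics"
  using vanishing_exposed_face exposed_face_of_def by blast

lemma vanishing_proper:
  assumes "p \<noteq> 0"
  shows "vanishing {p} \<noteq> nonneg_quartics"
proof -
  let ?f = "monomial (4,0,0) + monomial (0,4,0) + monomial (0,0,4)"
  have "?f \<in> nonneg_quartics" by (simp add: nonneg_quartics_iff quartic_eval_monomial)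
  moreover have "quartic_eval ?f p > 0"
  proof -
    have "0 \<le> p $ i ^ 4" "p $ i \<noteq> 0 \<Longrightarrow> 0 < p $ i ^ 4" for i by (simp_all add: zero_less_power_eq)
    moreover have "p $ 1 \<noteq> 0 \<or> p $ 2 \<noteq> 0 \<or> p $ 3 \<noteq> 0" using assms by (simp add: vec_eq_iff forall_3)
    moreover have "quartic_eval ?f p = p $ 1 ^ 4 + p $ 2 ^ 4 + p $ 3 ^ 4" by (simp add: quartic_eval_monomial)
    ultimately show ?thesis by (smt (verit))
  qed
  ultimately have "?f \<in> nonneg_quartics" "quartic_eval ?f p \<noteq> 0" by simp_all
  then show ?thesis unfolding vanishing_def by blast
qed

text \<open>
  On the compact unit sphere the quartic \<open>f\<close> is bounded below by a positive number and \<open>g\<close> is bounded above;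
  homogeneity carries the comparison to all of space. In effect, \<open>f\<close> is an interior point of the cone.
\<close>

lemma positive_quartic_dominates:
  assumes pos: "\<And>x. x \<noteq> 0 \<Longrightarrow> 0 < quartic_eval f x"
  obtains e where "e > 0" "f - e *\<^sub>R g \<in> nonneg_quartics"
proof -
  let ?S = "sphere (0 :: real ^ 3) 1"
  have S: "compact ?S" "?S \<noteq> {}" by auto
  obtain a where a: "a \<in> ?S" "\<And>x. x \<in> ?S \<Longrightarrow> quartic_eval f a \<le> quartic_eval f x"
    using continuous_attains_inf[OF S continuous_on_quartic_eval] by blast
  obtain b where b: "b \<in> ?S" "\<And>x. x \<in> ?S \<Longrightarrow> quartic_eval g x \<le> quartic_eval g b"
    using continuous_attains_sup[OF S continuous_on_quartic_eval] by blast
  have fa: "quartic_eval f a > 0" using a(1) by (intro pos) auto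
  \<comment> \<open>The summand 1 keeps the bound positive even when \<open>g\<close> vanishes at its maximum.\<close>
  define M where "M = \<bar>quartic_eval g b\<bar> + 1"
  have M: "M > 0" by (simp add: M_def)
  \<comment> \<open>With this choice \<open>e g\<close> is at most the minimum of \<open>f\<close> on the sphere.\<close>
  define e where "e = quartic_eval f a / M"
  have e: "e > 0" using fa M by (simp add: e_def)
  have S: "0 \<le> quartic_eval (f - e *\<^sub>R g) x" if "x \<in> ?S" for x
  proof -
    have "e * quartic_eval g x \<le> e * M"
      using b(2)[OF that] e by (intro mult_left_mono) (auto simp: M_def)
    also have "\<dots> = quartic_eval f a" using M by (simp add: e_def)
    finally show ?thesis using a(2)[OF that] by simp
  qed
  have "0 \<le> quartic_eval (f - e *\<^sub>R g) x" for x
  proof (cases "x = 0")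
    case True
    then show ?thesis using quartic_eval_scale[of _ 0 x] by simp
  next
    case False
    have "x = norm x *\<^sub>R sgn x" using False by (simp add: sgn_div_norm)
    then have "quartic_eval (f - e *\<^sub>R g) x = norm x ^ 4 * quartic_eval (f - e *\<^sub>R g) (sgn x)"
      by (metis quartic_eval_scale)
    moreover have "sgn x \<in> ?S" using False by (simp add: norm_sgn)
    ultimately show ?thesis using S by simp
  qed
  then show ?thesis using that e by (simp add: nonneg_quartics_iff)
qed

text \<open>
  A relative interior point \<open>f\<close> of a proper face has a zero \<open>p\<close>, for otherwise it would dominate every
  quartic of the cone up to a factor. Evaluation at \<open>p\<close> is non-negative on the face and zero at
  a relative interior point, so it is zero on the whole face.
\<close>

lemma proper_face_subset_vanishing:
  assumes F: "F face_of nonneg_quartics" "F \<noteq> nonneg_quartics"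
  obtains p where "p \<noteq> 0" "F \<subseteq> vanishing {p}"
proof (cases "F = {}")
  case True
  then show ?thesis using that[of "axis 1 1"] by simp
next
  case False
  note conv = face_of_imp_convex[OF F(1)] and sub = face_of_imp_subset[OF F(1)]
  from False conv obtain f where f: "f \<in> rel_interior F"
    using rel_interior_eq_empty by blast
  then have fF: "f \<in> F" using rel_interior_subset by blast
  have "\<exists>p. p \<noteq> 0 \<and> quartic_eval f p = 0"
  proof (rule ccontr)
    assume "\<not> ?thesis"
    then have pos: "0 < quartic_eval f x" if "x \<noteq> 0" for x
      using that fF sub by (force simp: nonneg_quartics_iff less_le)
    have "g \<in> F" if "g \<in> nonneg_quartics" for g
      using positive_quartic_dominates[OF pos] dominated_mem_face_of_cone[OF cone_nonneg_quartics F(1) fF that]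
      by metis
    then show False using F(2) sub by blast
  qed
  then obtain p where p: "p \<noteq> 0" "quartic_eval f p = 0" by blast
  have "quartic_eval g p = 0" if g: "g \<in> F" for g
  proof -
    obtain m where m: "m > 1" "(1 - m) *\<^sub>R g + m *\<^sub>R f \<in> F"
      using convex_rel_interior_if[OF conv f] hull_inc[OF g] by blast
    then have "0 \<le> quartic_eval ((1 - m) *\<^sub>R g + m *\<^sub>R f) p"
      using sub nonneg_quartics_iff by blast
    then have "0 \<le> (1 - m) * quartic_eval g p" using p(2) by simp
    moreover have "0 \<le> quartic_eval g p" using g sub by (auto simp: nonneg_quartics_iff)
    ultimately show ?thesis using m(1) by (simp add: zero_le_mult_iff)
  qed
  then have "F \<subseteq> vanishing {p}" using sub by (auto simp: vanishing_def)
  with p(1) show ?thesis by (rule that)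
qed

lemma facet_eq_vanishing:
  assumes "is_facet nonneg_quartics F"
  obtains p where "p \<noteq> 0" "F = vanishing {p}"
  using assms proper_face_subset_vanishing vanishing_face vanishing_proper
  unfolding is_facet_def by metis

lemma vanishing_scale:
  assumes "c \<noteq> 0"
  shows "vanishing {c *\<^sub>R p} = vanishing {p}"
  using assms by (auto simp: vanishing_def quartic_eval_scale)

lemma pullback_image_vanishing:
  assumes "linear A" "linear B" "\<And>x. A (B x) = x" "\<And>x. B (A x) = x"
  shows "pullback A ` vanishing (A ` P) = vanishing P"
proof -
  have sub: "pullback A ` vanishing (A ` P) \<subseteq> vanishing P" if "linear A" for A P
    using that by (auto simp: vanishing_def nonneg_quartics_iff quartic_eval_pullback)
  have "B ` A ` P = P" using assms(4) by (simp add: image_image)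
  then have "pullback B ` vanishing P \<subseteq> vanishing (A ` P)" using sub[OF assms(2), of "A ` P"] by simp
  then have "pullback A ` pullback B ` vanishing P \<subseteq> pullback A ` vanishing (A ` P)" by blast
  moreover have "pullback A ` pullback B ` vanishing P = vanishing P"
    using pullback_pullback[OF assms(2,1,4)] by (simp add: image_image)
  ultimately show ?thesis using sub[OF assms(1)] by blast
qed

text \<open>
  Substitution of an invertible linear map is a linear automorphism of the space of quartics; it preserves
  the cone and moves the zeros.
\<close>

lemma aff_dim_vanishing_image:
  assumes "linear A" "inj A"
  shows "aff_dim (vanishing (A ` P)) = aff_dim (vanishing P)"
proof -
  obtain B where B: "linear B" "\<And>x. B (A x) = x" "\<And>x. A (B x) = x"
    using linear_injective_isomorphism[OF assms] by blast
  have "inj (pullback A)"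
    using pullback_pullback[OF assms(1) B(1,3)] by (metis injI)
  then have "aff_dim (pullback A ` vanishing (A ` P)) = aff_dim (vanishing (A ` P))"
    using linear_pullback[OF assms(1)] by simp
  then show ?thesis using pullback_image_vanishing[OF assms(1) B(1,3,2)] by simp
qed

text \<open>
  The third basis vector is sent to the cross product of \<open>p\<close> and \<open>q\<close>.
\<close>

lemma linear_two_points:
  assumes "\<not> collinear {0, p, q :: real ^ 3}"
  obtains A :: "real ^ 3 \<Rightarrow> real ^ 3" where "linear A" "inj A" "A (axis 1 1) = p" "A (axis 2 1) = q"
proof -
  let ?n = "cross3 p q"
  let ?A = "\<lambda>x :: real ^ 3. x $ 1 *\<^sub>R p + x $ 2 *\<^sub>R q + x $ 3 *\<^sub>R ?n"
  have n: "?n \<noteq> 0" using assms by (simp add: cross_eq_0)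
  have l: "linear ?A" by (rule linearI) (simp_all add: algebra_simps)
  have "?A (axis 1 1) = p" "?A (axis 2 1) = q" by (simp_all add: axis_def)
  moreover have "inj ?A"
  proof -
    have "x = 0" if "?A x = 0" for x
    proof -
      have "?n \<bullet> ?A x = x $ 3 * (?n \<bullet> ?n)"
        by (simp add: inner_add_right dot_cross_self inner_commute)
      then have 3: "x $ 3 = 0" using n that by simp
      have "cross3 p (?A x) = x $ 2 *\<^sub>R ?n" "cross3 (?A x) q = x $ 1 *\<^sub>R ?n"
        using 3 by (simp_all add: cross_add_right cross_mult_right cross_add_left cross_mult_left)
      then have "x $ 2 *\<^sub>R ?n = 0" "x $ 1 *\<^sub>R ?n = 0" unfolding that by simp_all
      then have "x $ 1 = 0" "x $ 2 = 0" using n by simp_all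
      then show "x = 0" using 3 by (simp add: vec_eq_iff forall_3)
    qed
    then show ?thesis using linear_injective_0[OF l] by blast
  qed
  ultimately show ?thesis using that[of ?A] l by blast
qed

lemma aff_dim_vanishing_two:
  assumes "\<not> collinear {0, p, q :: real ^ 3}"
  shows "aff_dim (vanishing {p, q}) = aff_dim (vanishing {axis 1 1, axis 2 1})"
proof -
  obtain A :: "real ^ 3 \<Rightarrow> real ^ 3" where "linear A" "inj A" "A (axis 1 1) = p" "A (axis 2 1) = q"
    using linear_two_points[OF assms] .
  then show ?thesis using aff_dim_vanishing_image[of A "{axis 1 1, axis 2 1}"] by simp
qed

text \<open>
  Any second point off the line through \<open>p\<close> completes a coordinate system.
\<close>

lemma aff_dim_vanishing_one:
  assumes "p \<noteq> 0"
  shows "aff_dim (vanishing {p}) = aff_dim (vanishing {axis 1 1})"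
proof -
  obtain q where "q \<noteq> 0" "orthogonal p q"
    using orthogonal_to_vector_exists[of p] by auto
  then have "\<not> collinear {0, p, q}"
    using assms norm_and_cross_eq_0[of p q] by (simp add: orthogonal_def cross_eq_0)
  then obtain A :: "real ^ 3 \<Rightarrow> real ^ 3" where "linear A" "inj A" "A (axis 1 1) = p"
    using linear_two_points[of p q] by metis
  then show ?thesis using aff_dim_vanishing_image[of A "{axis 1 1}"] by simp
qed

section \<open>Vanishing coefficients and dimensions\<close>

text \<open>
  Restricting a non-negative quartic to a curve gives a non-negative polynomial in one variable. The
  next three lemmas read off from it that a lowest term of even degree has a non-negative coefficient and
  one of odd degree is absent.
\<close>

lemma lowest_coeff_nonneg:
  fixes a b c d :: real
  assumes "\<And>t. t > 0 \<Longrightarrow> 0 \<le> a + b * t + c * t^2 + d * t^3"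
  shows "0 \<le> a"
proof (rule tendsto_lowerbound)
  have "((\<lambda>t. a + b * t + c * t^2 + d * t^3) \<longlongrightarrow> a + b * 0 + c * 0^2 + d * 0^3) (at_right 0)"
    by (intro tendsto_intros)
  then show "((\<lambda>t. a + b * t + c * t^2 + d * t^3) \<longlongrightarrow> a) (at_right 0)" by simp
  show "\<forall>\<^sub>F t in at_right 0. 0 \<le> a + b * t + c * t^2 + d * t^3"
    using eventually_at_right_less[of "0::real"] by eventually_elim (rule assms)
qed simp

lemma linear_coeff_eq_0:
  fixes a b c d :: real
  assumes "\<And>t. 0 \<le> a * t + b * t^2 + c * t^3 + d * t^4"
  shows "a = 0"
proof (rule antisym)
  have pos: "0 \<le> y" if "0 < x" "0 \<le> x * y" for x y :: real
    using that by (metis mult_pos_neg not_le)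
  have "0 \<le> a + b * t + c * t^2 + d * t^3" if "t > 0" for t
  proof (rule pos[OF that])
    have "t * (a + b * t + c * t^2 + d * t^3) = a * t + b * t^2 + c * t^3 + d * t^4"
      by (simp add: algebra_simps power2_eq_square power3_eq_cube power4_eq_xxxx)
    then show "0 \<le> t * (a + b * t + c * t^2 + d * t^3)" using assms[of t] by (simp only:)
  qed
  then show "0 \<le> a" by (rule lowest_coeff_nonneg)
  have "0 \<le> - a + b * t + (- c) * t^2 + d * t^3" if "t > 0" for t
  proof (rule pos[OF that])
    have "t * (- a + b * t + (- c) * t^2 + d * t^3)
        = a * (- t) + b * (- t)^2 + c * (- t)^3 + d * (- t)^4"
      by (simp add: algebra_simps power2_eq_square power3_eq_cube power4_eq_xxxx)
    then show "0 \<le> t * (- a + b * t + (- c) * t^2 + d * t^3)" using assms[of "- t"] by (simp only:)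
  qed
  then have "0 \<le> - a" by (rule lowest_coeff_nonneg)
  then show "a \<le> 0" by simp
qed

lemma quadratic_coeff_nonneg:
  fixes b c d :: real
  assumes "\<And>t. 0 \<le> b * t^2 + c * t^3 + d * t^4"
  shows "0 \<le> b"
proof (rule lowest_coeff_nonneg)
  fix t :: real assume t: "t > 0"
  have "t^2 * (b + c * t + d * t^2 + 0 * t^3) = b * t^2 + c * t^3 + d * t^4"
    by (simp add: algebra_simps power2_eq_square power3_eq_cube power4_eq_xxxx)
  then have "0 \<le> t^2 * (b + c * t + d * t^2 + 0 * t^3)" using assms[of t] by (simp only:)
  moreover have "0 < t^2" using t by simp
  ultimately show "0 \<le> b + c * t + d * t^2 + 0 * t^3"
    by (metis mult_pos_neg not_le)
qed

text \<open>
  In adapted coordinates all faces that occur are cut out of the cone by coefficients that vanish.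
\<close>

definition sparse_quartics :: "(nat \<times> nat \<times> nat) set \<Rightarrow> quartic set" where
  "sparse_quartics E = {f \<in> nonneg_quartics. \<forall>t\<in>E. quartic_coeff f t = 0}"

fun exponent_add :: "nat \<times> nat \<times> nat \<Rightarrow> nat \<times> nat \<times> nat \<Rightarrow> nat \<times> nat \<times> nat" where
  "exponent_add (i, j, k) (i', j', k') = (i + i', j + j', k + k')"

definition exponent_sums :: "(nat \<times> nat \<times> nat) set \<Rightarrow> (nat \<times> nat \<times> nat) set" where
  "exponent_sums V = (\<Union>u\<in>V. \<Union>v\<in>V. {exponent_add u v})"

text \<open>
  Here \<open>V\<close> is a set of quadratic monomials and \<open>D\<close> the set of products of two of them. For
  \<open>u, v \<in> V\<close> the quartics \<open>u\<^sup>2\<close>, \<open>v\<^sup>2\<close> and \<open>(u + v)\<^sup>2\<close> lie in the face, hence \<open>u v\<close> lies in its span.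
  So if no other monomial than those in \<open>D\<close> can occur in the face, its span is the coordinate subspace
  of \<open>D\<close>.
\<close>

lemma aff_dim_sparse_quartics:
  fixes V :: "(nat \<times> nat \<times> nat) set"
  defines "D \<equiv> exponent_sums V"
  assumes V: "\<And>i j k. (i, j, k) \<in> V \<Longrightarrow> i + j + k = 2"
    and E: "E \<subseteq> exponents4 - D"
    and vanish: "\<And>f t. f \<in> sparse_quartics E \<Longrightarrow> t \<in> exponents4 - D \<Longrightarrow> quartic_coeff f t = 0"
  shows "aff_dim (sparse_quartics E) = int (card D)"
proof -
  let ?C = "sparse_quartics E"
  let ?d = "quartic_monom_of ` D"
  let ?S = "{f :: quartic. \<forall>m. m \<notin> ?d \<longrightarrow> f $ m = 0}"
  have D: "D \<subseteq> exponents4"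
  proof -
    have "exponent_add u v \<in> exponents4" if "u \<in> V" "v \<in> V" for u v
    proof -
      obtain i j k i' j' k' where e: "u = (i, j, k)" "v = (i', j', k')" by (cases u; cases v) auto
      then show ?thesis using V[of i j k] V[of i' j' k'] that by (simp add: exponents4_def)
    qed
    then show ?thesis by (auto simp: D_def exponent_sums_def)
  qed
  have coeff: "quartic_coeff (monomial t) s = 0" if "t \<in> D" "s \<in> E" for s t
  proof -
    have "t \<in> exponents4" "s \<in> exponents4" "t \<noteq> s" using that D E by auto
    then show ?thesis by (auto simp: exponents4_def quartic_coeff_monomial split: if_splits)
  qed
  have monom: "monomial (exponent_add u v) \<in> span ?C" if uv: "u \<in> V" "v \<in> V" for u v
  proof -
    let ?s = "monomial (exponent_add u u) + monomial (exponent_add v v) + 2 *\<^sub>R monomial (exponent_add u v)"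
    have inD: "exponent_add u u \<in> D" "exponent_add v v \<in> D" "exponent_add u v \<in> D"
      using uv by (auto simp: D_def exponent_sums_def)
    have eval: "quartic_eval (monomial (exponent_add a b)) x = monomial_fun a x * monomial_fun b x"
      if "a \<in> V" "b \<in> V" for a b x
    proof -
      obtain i j k i' j' k' where e: "a = (i, j, k)" "b = (i', j', k')" by (cases a; cases b) auto
      then have "(i + i') + (j + j') + (k + k') = 4" using V[of i j k] V[of i' j' k'] that by simp
      from quartic_eval_monomial[OF this] show ?thesis by (simp add: e power_add)
    qed
    have sq: "quartic_eval ?s x = (monomial_fun u x + monomial_fun v x)^2" for x
      using uv by (simp add: eval power2_eq_square algebra_simps)
    have "?s \<in> ?C"
      using inD coeff sq by (simp add: sparse_quartics_def nonneg_quartics_iff del: quartic_eval_linear)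
    moreover have "monomial (exponent_add a a) \<in> ?C" if "a \<in> V" "exponent_add a a \<in> D" for a
      using that coeff eval[of a a] by (simp add: sparse_quartics_def nonneg_quartics_iff)
    ultimately have "(1/2) *\<^sub>R (?s - monomial (exponent_add u u) - monomial (exponent_add v v)) \<in> span ?C"
      using uv inD by (intro span_scale span_diff span_base) auto
    then show ?thesis by (simp add: algebra_simps)
  qed
  have "span ?C = ?S"
  proof
    have "?C \<subseteq> ?S"
    proof
      fix f assume f: "f \<in> ?C"
      have "f $ m = 0" if "m \<notin> ?d" for m
      proof -
        obtain t where "t \<in> exponents4" "m = quartic_monom_of t"
          using bij_betw_imp_surj_on[OF bij_betw_quartic_monom_of] by blast
        then show ?thesis using vanish[OF f, of t] that by (auto simp: quartic_coeff_def)
      qed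
      then show "f \<in> ?S" by simp
    qed
    then show "span ?C \<subseteq> ?S"
      by (rule span_minimal) (auto simp: subspace_def)
    show "?S \<subseteq> span ?C"
    proof
      fix f assume f: "f \<in> ?S"
      have "f = (\<Sum>m\<in>UNIV. f $ m *\<^sub>R axis m 1)"
        using basis_expansion[of f] by (simp add: scalar_mult_eq_scaleR)
      moreover have "f $ m *\<^sub>R axis m 1 \<in> span ?C" for m
      proof (cases "m \<in> ?d")
        case True
        then have "axis m 1 \<in> span ?C"
          using monom by (auto simp: D_def exponent_sums_def monomial_def)
        then show ?thesis by (rule span_scale)
      qed (use f in \<open>simp add: span_zero\<close>)
      ultimately show "f \<in> span ?C" by (metis (no_types, lifting) span_sum)
    qed
  qed
  then have "dim ?C = dim ?S" by (metis dim_span)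
  also have "\<dots> = card ?d"
    using dim_substandard_cart[where 'a = real, of ?d] by (simp add: dim_vec_eq)
  also have "\<dots> = card D"
    using D bij_betw_imp_inj_on[OF bij_betw_quartic_monom_of] by (intro card_image) (rule inj_on_subset)
  finally have "dim ?C = card D" .
  moreover have "0 \<in> affine hull ?C" by (rule hull_inc) (simp add: sparse_quartics_def nonneg_quartics_iff)
  ultimately show ?thesis by (simp add: aff_dim_zero)
qed

lemma vanishing_axis1: "vanishing {axis 1 1} = sparse_quartics {(4,0,0)}"
  by (simp add: vanishing_def sparse_quartics_def quartic_eval_explicit axis_def)

lemma vanishing_axis12: "vanishing {axis 1 1, axis 2 1} = sparse_quartics {(4,0,0), (0,4,0)}"
  by (simp add: vanishing_def sparse_quartics_def quartic_eval_explicit axis_def)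

text \<open>
  A zero of a non-negative quartic is a minimum, so the first-order terms there vanish as well, and
  the second-order terms are non-negative.
\<close>

lemma tangent_coeffs_axis1:
  assumes "f \<in> nonneg_quartics" "quartic_coeff f (4,0,0) = 0"
  shows "quartic_coeff f (3,1,0) = 0" "quartic_coeff f (3,0,1) = 0" "0 \<le> quartic_coeff f (2,0,2)"
proof -
  have nn: "0 \<le> quartic_eval f x" for x using assms(1) by (simp add: nonneg_quartics_iff)
  show "quartic_coeff f (3,1,0) = 0"
    by (rule linear_coeff_eq_0[where b = "quartic_coeff f (2,2,0)" and c = "quartic_coeff f (1,3,0)" and d = "quartic_coeff f (0,4,0)"])
      (use nn[of "vector [1, t, 0]" for t] assms(2) in \<open>simp add: quartic_eval_explicit vector_3\<close>)
  show 301: "quartic_coeff f (3,0,1) = 0"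
    by (rule linear_coeff_eq_0[where b = "quartic_coeff f (2,0,2)" and c = "quartic_coeff f (1,0,3)" and d = "quartic_coeff f (0,0,4)"])
      (use nn[of "vector [1, 0, t]" for t] assms(2) in \<open>simp add: quartic_eval_explicit vector_3\<close>)
  show "0 \<le> quartic_coeff f (2,0,2)"
    by (rule quadratic_coeff_nonneg[where c = "quartic_coeff f (1,0,3)" and d = "quartic_coeff f (0,0,4)"])
      (use nn[of "vector [1, 0, t]" for t] assms(2) 301 in \<open>simp add: quartic_eval_explicit vector_3\<close>)
qed

lemma tangent_coeffs_axis2:
  assumes "f \<in> nonneg_quartics" "quartic_coeff f (0,4,0) = 0"
  shows "quartic_coeff f (1,3,0) = 0" "quartic_coeff f (0,3,1) = 0"
proof -
  have nn: "0 \<le> quartic_eval f x" for x using assms(1) by (simp add: nonneg_quartics_iff)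
  show "quartic_coeff f (1,3,0) = 0"
    by (rule linear_coeff_eq_0[where b = "quartic_coeff f (2,2,0)" and c = "quartic_coeff f (3,1,0)" and d = "quartic_coeff f (4,0,0)"])
      (use nn[of "vector [t, 1, 0]" for t] assms(2) in \<open>simp add: quartic_eval_explicit vector_3 ac_simps\<close>)
  show "quartic_coeff f (0,3,1) = 0"
    by (rule linear_coeff_eq_0[where b = "quartic_coeff f (0,2,2)" and c = "quartic_coeff f (0,1,3)" and d = "quartic_coeff f (0,0,4)"])
      (use nn[of "vector [0, 1, t]" for t] assms(2) in \<open>simp add: quartic_eval_explicit vector_3\<close>)
qed

text \<open>
  At a zero where the Hessian is degenerate in the direction \<open>z\<close>, a positive semidefinite
  Hessian has no \<open>y z\<close> term, and then no cubic term \<open>z\<^sup>3\<close> can remain either. The first claim is read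
  off along the curves \<open>(1, s t, s)\<close>, whose lowest term in \<open>s\<close> is the Hessian at \<open>(0, t, 1)\<close>.
\<close>

lemma flat_coeffs_axis1:
  assumes "f \<in> nonneg_quartics" "quartic_coeff f (4,0,0) = 0" "quartic_coeff f (2,0,2) = 0"
  shows "quartic_coeff f (2,1,1) = 0" "quartic_coeff f (1,0,3) = 0"
proof -
  have nn: "0 \<le> quartic_eval f x" for x using assms(1) by (simp add: nonneg_quartics_iff)
  note z = assms(2,3) tangent_coeffs_axis1[OF assms(1,2)]
  let ?c = "quartic_coeff f"
  have "0 \<le> ?c (2,1,1) * t + ?c (2,2,0) * t^2" for t
  proof (rule quadratic_coeff_nonneg)
    fix s
    have "quartic_eval f (vector [1, s * t, s])
        = (?c (2,1,1) * t + ?c (2,2,0) * t^2) * s^2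
        + (?c (1,3,0) * t^3 + ?c (1,2,1) * t^2 + ?c (1,1,2) * t + ?c (1,0,3)) * s^3
        + (?c (0,4,0) * t^4 + ?c (0,3,1) * t^3 + ?c (0,2,2) * t^2 + ?c (0,1,3) * t + ?c (0,0,4)) * s^4"
      using z by (simp add: quartic_eval_explicit vector_3 power_mult_distrib algebra_simps
        power2_eq_square power3_eq_cube power4_eq_xxxx)
    then show "0 \<le> (?c (2,1,1) * t + ?c (2,2,0) * t^2) * s^2
        + (?c (1,3,0) * t^3 + ?c (1,2,1) * t^2 + ?c (1,1,2) * t + ?c (1,0,3)) * s^3
        + (?c (0,4,0) * t^4 + ?c (0,3,1) * t^3 + ?c (0,2,2) * t^2 + ?c (0,1,3) * t + ?c (0,0,4)) * s^4"
      using nn by metis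
  qed
  then show "?c (2,1,1) = 0" using linear_coeff_eq_0[of "?c (2,1,1)" "?c (2,2,0)" 0 0] by simp
  have cub: "0 \<le> ?c (1,0,3) * t^3 + ?c (0,0,4) * t^4" for t
    using nn[of "vector [1, 0, t]"] z by (simp add: quartic_eval_explicit vector_3)
  have "0 \<le> ?c (1,0,3) * t + ?c (0,0,4) * t^2" for t
  proof (cases "t = 0")
    case False
    have "?c (1,0,3) * t^3 + ?c (0,0,4) * t^4 = t^2 * (?c (1,0,3) * t + ?c (0,0,4) * t^2)"
      by (simp add: algebra_simps power2_eq_square power3_eq_cube power4_eq_xxxx)
    then show ?thesis using cub[of t] False by (simp add: zero_le_mult_iff)
  qed simp
  then show "?c (1,0,3) = 0" using linear_coeff_eq_0[of "?c (1,0,3)" "?c (0,0,4)" 0 0] by simp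
qed

lemma aff_dim_vanishing_axis1: "aff_dim (vanishing {axis 1 1}) = 12"
proof -
  let ?V = "{(1,1,0), (1,0,1), (0,2,0), (0,1,1), (0,0,2)} :: (nat \<times> nat \<times> nat) set"
  have D: "exponent_sums ?V = {(2,2,0), (2,1,1), (2,0,2), (1,3,0), (1,2,1), (1,1,2),
     (1,0,3), (0,4,0), (0,3,1), (0,2,2), (0,1,3), (0,0,4)}"
    by (simp add: exponent_sums_def insert_commute numeral_eq_Suc)
  have "aff_dim (sparse_quartics {(4,0,0)}) = int (card (exponent_sums ?V))"
  proof (rule aff_dim_sparse_quartics)
    fix f t assume "f \<in> sparse_quartics {(4,0,0)}" "t \<in> exponents4 - exponent_sums ?V"
    then show "quartic_coeff f t = 0"
      unfolding D exponents4_explicit using tangent_coeffs_axis1[of f] by (auto simp: sparse_quartics_def)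
  qed (unfold D exponents4_explicit, auto)
  then show ?thesis unfolding vanishing_axis1 D by simp
qed

lemma aff_dim_vanishing_axis12: "aff_dim (vanishing {axis 1 1, axis 2 1}) = 9"
proof -
  let ?V = "{(1,1,0), (1,0,1), (0,1,1), (0,0,2)} :: (nat \<times> nat \<times> nat) set"
  let ?E = "{(4,0,0), (0,4,0)} :: (nat \<times> nat \<times> nat) set"
  have D: "exponent_sums ?V = {(2,2,0), (2,1,1), (2,0,2), (1,2,1), (1,1,2),
     (1,0,3), (0,2,2), (0,1,3), (0,0,4)}"
    by (simp add: exponent_sums_def insert_commute numeral_eq_Suc)
  have "aff_dim (sparse_quartics ?E) = int (card (exponent_sums ?V))"
  proof (rule aff_dim_sparse_quartics)
    fix f t assume "f \<in> sparse_quartics ?E" "t \<in> exponents4 - exponent_sums ?V"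
    then show "quartic_coeff f t = 0"
      unfolding D exponents4_explicit using tangent_coeffs_axis1[of f] tangent_coeffs_axis2[of f]
      by (auto simp: sparse_quartics_def)
  qed (unfold D exponents4_explicit, auto)
  then show ?thesis unfolding vanishing_axis12 D by simp
qed

section \<open>A maximal non-exposed face\<close>

text \<open>
  The quartics that vanish at \<open>(1, 0, 0)\<close> with a Hessian that is degenerate in the direction
  \<open>(0, 0, 1)\<close>. This is an exposed face of a facet, but not of the whole cone.
\<close>

definition flat_face :: "quartic set" where
  "flat_face = sparse_quartics {(4,0,0), (2,0,2)}"

lemma aff_dim_flat_face: "aff_dim flat_face = 9"
proof -
  let ?V = "{(1,1,0), (0,2,0), (0,1,1), (0,0,2)} :: (nat \<times> nat \<times> nat) set"
  let ?E = "{(4,0,0), (2,0,2)} :: (nat \<times> nat \<times> nat) set"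
  have D: "exponent_sums ?V = {(2,2,0), (1,3,0), (1,2,1), (1,1,2),
     (0,4,0), (0,3,1), (0,2,2), (0,1,3), (0,0,4)}"
    by (simp add: exponent_sums_def insert_commute numeral_eq_Suc)
  have "aff_dim (sparse_quartics ?E) = int (card (exponent_sums ?V))"
  proof (rule aff_dim_sparse_quartics)
    fix f t assume "f \<in> sparse_quartics ?E" "t \<in> exponents4 - exponent_sums ?V"
    then show "quartic_coeff f t = 0"
      unfolding D exponents4_explicit using tangent_coeffs_axis1[of f] flat_coeffs_axis1[of f]
      by (auto simp: sparse_quartics_def)
  qed (unfold D exponents4_explicit, auto)
  then show ?thesis unfolding flat_face_def D by simp
qed

lemma flat_face_face: "flat_face face_of nonneg_quartics"
proof -
  let ?a = "axis (quartic_monom_of (2,0,2)) 1 :: quartic"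
  have a: "?a \<bullet> f = quartic_coeff f (2,0,2)" for f by (simp add: inner_axis' quartic_coeff_def)
  have "flat_face = vanishing {axis 1 1} \<inter> {f. ?a \<bullet> f = 0}"
    unfolding a vanishing_axis1 flat_face_def by (auto simp: sparse_quartics_def)
  also have "\<dots> face_of vanishing {axis 1 1}"
  proof (rule face_of_Int_supporting_hyperplane_ge)
    show "convex (vanishing {axis 1 1})" by (rule face_of_imp_convex[OF vanishing_face])
    show "0 \<le> ?a \<bullet> f" if "f \<in> vanishing {axis 1 1}" for f
      using that tangent_coeffs_axis1(3) by (simp add: a vanishing_axis1 sparse_quartics_def)
  qed
  also note vanishing_face
  finally show ?thesis .
qed

text \<open>
  A functional that is non-negative on the cone and vanishes at \<open>z\<^sup>4\<close> also vanishes at \<open>x\<^sup>2 z\<^sup>2\<close>, by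
  testing it on \<open>(x\<^sup>2 + t z\<^sup>2)\<^sup>2\<close> for all real \<open>t\<close>. But \<open>z\<^sup>4\<close> belongs to the face and \<open>x\<^sup>2 z\<^sup>2\<close> does not.
\<close>

lemma flat_face_not_exposed: "\<not> flat_face exposed_face_of nonneg_quartics"
proof
  assume "flat_face exposed_face_of nonneg_quartics"
  then obtain a b where a: "\<And>f. f \<in> nonneg_quartics \<Longrightarrow> a \<bullet> f \<le> b"
    and flat: "\<And>f. f \<in> flat_face \<longleftrightarrow> f \<in> nonneg_quartics \<and> a \<bullet> f = b"
    unfolding exposed_face_of_def by blast
  have "0 \<in> flat_face" by (simp add: flat_face_def sparse_quartics_def nonneg_quartics_iff)
  then have b: "b = 0" using flat by simp
  have "monomial (0,0,4) \<in> flat_face"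
    by (simp add: flat_face_def sparse_quartics_def nonneg_quartics_iff quartic_eval_monomial quartic_coeff_monomial)
  then have z4: "a \<bullet> monomial (0,0,4) = 0" using flat b by simp
  let ?L = "\<lambda>t. - (a \<bullet> monomial t)"
  have lin: "0 \<le> ?L (4,0,0) + (2 * ?L (2,0,2)) * t" for t
  proof -
    \<comment> \<open>\<open>(x\<^sup>2 + t z\<^sup>2)\<^sup>2\<close>: its value under the functional is affine in \<open>t\<close> because \<open>z\<^sup>4\<close> contributes nothing.\<close>
    let ?f = "monomial (4,0,0) + (2 * t) *\<^sub>R monomial (2,0,2) + t^2 *\<^sub>R monomial (0,0,4)"
    have "quartic_eval ?f x = ((x $ 1)^2 + t * (x $ 3)^2)^2" for x
      by (simp add: quartic_eval_monomial algebra_simps power2_eq_square power4_eq_xxxx)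
    then have "?f \<in> nonneg_quartics" unfolding nonneg_quartics_iff by (metis zero_le_power2)
    from a[OF this] show ?thesis using z4 b by (simp add: inner_add_right algebra_simps)
  qed
  have "?L (2,0,2) = 0"
  proof (rule ccontr)
    assume "?L (2,0,2) \<noteq> 0"
    then show False using lin[of "(- 1 - ?L (4,0,0)) / (2 * ?L (2,0,2))"] by simp
  qed
  moreover have "monomial (2,0,2) \<in> nonneg_quartics"
    by (simp add: nonneg_quartics_iff quartic_eval_monomial)
  ultimately have "monomial (2,0,2) \<in> flat_face" using flat b by simp
  then show False by (simp add: flat_face_def sparse_quartics_def quartic_coeff_monomial)
qed

lemma abs_mult_le_of_squares_le:
  fixes u v S :: real
  assumes "u^2 \<le> S" "v^2 \<le> S"
  shows "\<bar>u * v\<bar> \<le> S"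
proof -
  have "0 \<le> (\<bar>u\<bar> - \<bar>v\<bar>)^2" by simp
  then have "2 * \<bar>u * v\<bar> \<le> u^2 + v^2" by (simp add: power2_diff abs_mult)
  then show ?thesis using assms by linarith
qed

text \<open>
  Every monomial of \<open>h\<close> other than \<open>x\<^sup>2 z\<^sup>2\<close> is a product of two of \<open>x z\<close>, \<open>x y\<close>, \<open>y\<^sup>2\<close>, \<open>y z\<close>, \<open>z\<^sup>2\<close>. The
  squares of the last four are bounded by \<open>S = x\<^sup>2 y\<^sup>2 + y\<^sup>4 + z\<^sup>4\<close>, so products among them are bounded by \<open>S\<close>;
  the two monomials that contain \<open>x z\<close> once are absorbed by \<open>x\<^sup>2 z\<^sup>2\<close> at the price of a multiple of \<open>S\<close>.
\<close>

lemma add_flat_quartic_nonneg: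
  assumes "quartic_coeff h (4,0,0) = 0" "quartic_coeff h (3,1,0) = 0" "quartic_coeff h (3,0,1) = 0"
    and c: "0 < quartic_coeff h (2,0,2)"
  obtains M where "0 \<le> M"
    "h + M *\<^sub>R (monomial (2,2,0) + monomial (0,4,0) + monomial (0,0,4)) \<in> nonneg_quartics"
proof -
  let ?g = "monomial (2,2,0) + monomial (0,4,0) + monomial (0,0,4)"
  let ?h = "quartic_coeff h"
  define c where "c = ?h (2,0,2)"
  define R :: "(nat \<times> nat \<times> nat) set" where "R = {(2,2,0), (1,3,0), (1,2,1), (1,1,2), (0,4,0), (0,3,1), (0,2,2), (0,1,3), (0,0,4)}"
  define M where "M = ?h (2,1,1)^2 / c + ?h (1,0,3)^2 / c + (\<Sum>t\<in>R. \<bar>?h t\<bar>)"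
  have M: "0 \<le> M" using c by (simp add: M_def c_def sum_nonneg)
  have "0 \<le> quartic_eval (h + M *\<^sub>R ?g) v" for v
  proof -
    define x y z where "x = v $ 1" and "y = v $ 2" and "z = v $ 3"
    define S where "S = (x * y)^2 + (y^2)^2 + (z^2)^2"
    have g: "quartic_eval ?g v = S"
      by (simp add: quartic_eval_monomial S_def x_def y_def z_def power_mult_distrib)
    have sq: "(x * y)^2 \<le> S" "(y^2)^2 \<le> S" "(z^2)^2 \<le> S" by (simp_all add: S_def)
    have "0 \<le> (y^2 - z^2)^2" by simp
    then have "2 * (y * z)^2 \<le> (y^2)^2 + (z^2)^2" by (simp add: power2_diff power_mult_distrib)
    then have yz: "(y * z)^2 \<le> S" using zero_le_power2[of "x * y"] zero_le_power2[of "y * z"] unfolding S_def by linarith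
    have bound: "- (\<bar>b\<bar> * S) \<le> b * (u * w)" if "u^2 \<le> S" "w^2 \<le> S" for b u w
    proof -
      have "\<bar>b * (u * w)\<bar> \<le> \<bar>b\<bar> * S"
        unfolding abs_mult[of b] using abs_mult_le_of_squares_le[OF that] by (intro mult_left_mono) auto
      then show ?thesis by linarith
    qed
    have absorb: "- (c / 4 * (x * z)^2) - b^2 / c * S \<le> b * ((x * z) * w)" if "w^2 \<le> S" for b w
    proof -
      have cp: "c > 0" using c by (simp add: c_def)
      \<comment> \<open>Completing the square; each of the two monomials with a single \<open>x z\<close> uses up a quarter of \<open>c (x z)\<^sup>2\<close>.\<close>
      have "0 \<le> c * (x * z / 2 + b * w / c)^2" using cp by simp
      also have "\<dots> = c / 4 * (x * z)^2 + b * ((x * z) * w) + b^2 / c * w^2"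
        using cp by (simp add: power2_eq_square field_simps)
      finally have "- (c / 4 * (x * z)^2) - b^2 / c * w^2 \<le> b * ((x * z) * w)" by simp
      moreover have "b^2 / c * w^2 \<le> b^2 / c * S" using that cp by (intro mult_left_mono) auto
      ultimately show ?thesis by linarith
    qed
    have "quartic_eval h v = c * (x * z)^2 + ?h (2,1,1) * ((x * z) * (x * y)) + ?h (1,0,3) * ((x * z) * z^2)
       + ?h (2,2,0) * ((x * y) * (x * y)) + ?h (1,3,0) * ((x * y) * y^2) + ?h (1,2,1) * ((x * y) * (y * z))
       + ?h (1,1,2) * ((x * y) * z^2) + ?h (0,4,0) * (y^2 * y^2) + ?h (0,3,1) * (y^2 * (y * z))
       + ?h (0,2,2) * ((y * z) * (y * z)) + ?h (0,1,3) * ((y * z) * z^2) + ?h (0,0,4) * (z^2 * z^2)"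
      unfolding quartic_eval_explicit assms x_def y_def z_def c_def
      by (simp add: algebra_simps power2_eq_square power3_eq_cube power4_eq_xxxx)
    moreover note absorb[OF sq(1), of "?h (2,1,1)"] absorb[OF sq(3), of "?h (1,0,3)"]
      bound[OF sq(1) sq(1), of "?h (2,2,0)"] bound[OF sq(1) sq(2), of "?h (1,3,0)"]
      bound[OF sq(1) yz, of "?h (1,2,1)"] bound[OF sq(1) sq(3), of "?h (1,1,2)"]
      bound[OF sq(2) sq(2), of "?h (0,4,0)"] bound[OF sq(2) yz, of "?h (0,3,1)"]
      bound[OF yz yz, of "?h (0,2,2)"] bound[OF yz sq(3), of "?h (0,1,3)"]
      bound[OF sq(3) sq(3), of "?h (0,0,4)"]
    moreover have "0 \<le> c * (x * z)^2" using c by (simp add: c_def)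
    moreover have "M * S = ?h (2,1,1)^2 / c * S + ?h (1,0,3)^2 / c * S
        + \<bar>?h (2,2,0)\<bar> * S + \<bar>?h (1,3,0)\<bar> * S + \<bar>?h (1,2,1)\<bar> * S + \<bar>?h (1,1,2)\<bar> * S + \<bar>?h (0,4,0)\<bar> * S
        + \<bar>?h (0,3,1)\<bar> * S + \<bar>?h (0,2,2)\<bar> * S + \<bar>?h (0,1,3)\<bar> * S + \<bar>?h (0,0,4)\<bar> * S"
      by (simp add: M_def R_def distrib_right)
    ultimately have "0 \<le> quartic_eval h v + M * S" by linarith
    then show ?thesis using g by simp
  qed
  then show ?thesis using that M nonneg_quartics_iff by blast
qed

text \<open>
  For \<open>k\<close> in the facet and small \<open>e > 0\<close>, the quartic \<open>f - e k\<close> still has a positive \<open>x\<^sup>2 z\<^sup>2\<close>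
  coefficient, so adding an element of the flat face makes it non-negative. Thus \<open>k\<close> is dominated by
  an element of \<open>F\<close>.
\<close>

lemma face_above_flat_face:
  assumes F: "F face_of nonneg_quartics" "flat_face \<subseteq> F" "f \<in> F" "quartic_coeff f (2,0,2) \<noteq> 0"
    and p: "F \<subseteq> vanishing {axis 1 1}"
  shows "F = vanishing {axis 1 1}"
proof
  have van: "quartic_coeff h (4,0,0) = 0" "quartic_coeff h (3,1,0) = 0" "quartic_coeff h (3,0,1) = 0"
    "0 \<le> quartic_coeff h (2,0,2)" "h \<in> nonneg_quartics" if "h \<in> vanishing {axis 1 1}" for h
    using that tangent_coeffs_axis1[of h] unfolding vanishing_axis1 by (auto simp: sparse_quartics_def)
  show "vanishing {axis 1 1} \<subseteq> F"
  proof
    fix k assume k: "k \<in> vanishing {axis 1 1}"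
    have f: "f \<in> vanishing {axis 1 1}" using F p by blast
    then have c: "0 < quartic_coeff f (2,0,2)" using van(4) F(4) by (simp add: less_le)
    \<comment> \<open>Small enough to keep the coefficient of \<open>x\<^sup>2 z\<^sup>2\<close> in \<open>f - e k\<close> positive.\<close>
    define e where "e = quartic_coeff f (2,0,2) / (2 * (quartic_coeff k (2,0,2) + 1))"
    have e: "e > 0" using c van(4)[OF k] by (simp add: e_def)
    have "e * quartic_coeff k (2,0,2) < quartic_coeff f (2,0,2)"
      using c van(4)[OF k] by (auto simp: e_def field_simps intro!: add_pos_nonneg)
    then obtain M where M: "0 \<le> M"
      "f - e *\<^sub>R k + M *\<^sub>R (monomial (2,2,0) + monomial (0,4,0) + monomial (0,0,4)) \<in> nonneg_quartics"
      (is "_ + _ *\<^sub>R ?g \<in> _")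
      using add_flat_quartic_nonneg[of "f - e *\<^sub>R k"] van(1-3)[OF f] van(1-3)[OF k] by auto
    have "?g \<in> flat_face"
      by (simp add: flat_face_def sparse_quartics_def nonneg_quartics_iff quartic_eval_monomial quartic_coeff_monomial)
    then have "M *\<^sub>R ?g \<in> F"
      using F(2) M(1) by (intro scale_mem_face_of_cone[OF cone_nonneg_quartics F(1)]) auto
    then have "f + M *\<^sub>R ?g \<in> F"
      by (rule add_mem_face_of_cone[OF cone_nonneg_quartics F(1,3)])
    moreover have "f + M *\<^sub>R ?g - e *\<^sub>R k \<in> nonneg_quartics" using M(2) by (simp add: algebra_simps)
    ultimately show "k \<in> F"
      using dominated_mem_face_of_cone[OF cone_nonneg_quartics F(1)] van(5)[OF k] e by blast
  qed
qed (rule p)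

text \<open>
  A face that is not exposed is proper, hence has a common zero. The member \<open>y\<^sup>4 + z\<^sup>4\<close> of the flat
  face allows only the zero \<open>(1, 0, 0)\<close>, and a face strictly above the flat face contains all
  non-negative quartics with this zero, which form an exposed face.
\<close>

lemma maximal_nonexposed_flat_face: "maximal_nonexposed_face nonneg_quartics flat_face"
  unfolding maximal_nonexposed_face_def
proof (intro conjI allI impI)
  show "nonexposed_face nonneg_quartics flat_face"
    using flat_face_face flat_face_not_exposed by (simp add: nonexposed_face_def)
  fix F assume F': "nonexposed_face nonneg_quartics F \<and> flat_face \<subseteq> F"
  then have F: "F face_of nonneg_quartics" "\<not> F exposed_face_of nonneg_quartics" "flat_face \<subseteq> F"
    by (auto simp: nonexposed_face_def)
  then have "F \<noteq> nonneg_quartics" using exposed_face_of_refl[OF convex_nonneg_quartics] by blast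
  then obtain p where p: "p \<noteq> 0" "F \<subseteq> vanishing {p}" using proper_face_subset_vanishing F(1) by blast
  have "monomial (0,4,0) + monomial (0,0,4) \<in> flat_face"
    by (simp add: flat_face_def sparse_quartics_def nonneg_quartics_iff quartic_eval_monomial quartic_coeff_monomial)
  then have "p $ 2 ^ 4 + p $ 3 ^ 4 = 0"
    using F(3) p(2) by (auto simp: vanishing_def quartic_eval_monomial dest!: subsetD)
  then have "p $ 2 = 0" "p $ 3 = 0" by (simp_all add: add_nonneg_eq_0_iff)
  then have pe: "p = p $ 1 *\<^sub>R axis 1 1" by (simp add: vec_eq_iff forall_3 axis_def)
  then have "p $ 1 \<noteq> 0" using p(1) by auto
  then have v: "vanishing {p} = vanishing {axis 1 1}" using vanishing_scale pe by metis
  show "F = flat_face"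
  proof (rule ccontr)
    assume "F \<noteq> flat_face"
    then obtain f where f: "f \<in> F" "f \<notin> flat_face" using F(3) by blast
    then have "quartic_coeff f (2,0,2) \<noteq> 0"
      using p(2) unfolding v vanishing_axis1 flat_face_def by (auto simp: sparse_quartics_def)
    then have "F = vanishing {axis 1 1}"
      using face_above_flat_face F(1,3) f(1) p(2) v by metis
    then show False using F(2) vanishing_exposed_face by metis
  qed
qed

section \<open>Facets\<close>

lemma aff_dim_facet:
  assumes "is_facet nonneg_quartics F"
  shows "aff_dim F = 12"
  using facet_eq_vanishing[OF assms] aff_dim_vanishing_one aff_dim_vanishing_axis1 by metis

lemma facet_Int_facet:
  assumes "is_facet nonneg_quartics F" "is_facet nonneg_quartics G" "F \<noteq> G"
  shows "(F \<inter> G) exposed_face_of nonneg_quartics" "aff_dim (F \<inter> G) = 9"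
proof -
  obtain p q where p: "p \<noteq> 0" "F = vanishing {p}" and q: "q \<noteq> 0" "G = vanishing {q}"
    using facet_eq_vanishing assms(1,2) by metis
  show "(F \<inter> G) exposed_face_of nonneg_quartics"
    unfolding p q by (intro exposed_face_of_Int vanishing_exposed_face)
  have "\<not> collinear {0, p, q}"
  proof
    assume "collinear {0, p, q}"
    then obtain c where "q = c *\<^sub>R p" using p(1) q(1) by (auto simp: collinear_lemma)
    then show False using assms(3) p q vanishing_scale[of c p] by auto
  qed
  then show "aff_dim (F \<inter> G) = 9"
    unfolding p q vanishing_insert by (simp add: aff_dim_vanishing_two aff_dim_vanishing_axis12)
qed

section \<open>The cone is not a spectrahedron\<close>

definition matrix_form :: "nat \<Rightarrow> (nat \<Rightarrow> nat \<Rightarrow> real) \<Rightarrow> (nat \<Rightarrow> real) \<Rightarrow> (nat \<Rightarrow> real) \<Rightarrow> real" where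
  "matrix_form n M u v = (\<Sum>i<n. \<Sum>j<n. u i * M i j * v j)"

lemma matrix_form_commute:
  assumes "symmetric_matrix n M"
  shows "matrix_form n M u v = matrix_form n M v u"
proof -
  have "matrix_form n M u v = (\<Sum>j<n. \<Sum>i<n. u i * M i j * v j)"
    unfolding matrix_form_def by (rule sum.swap)
  also have "\<dots> = matrix_form n M v u"
    unfolding matrix_form_def using assms
    by (intro sum.cong refl) (auto simp: symmetric_matrix_def)
  finally show ?thesis .
qed

lemma matrix_form_sum_left:
  "matrix_form n M (\<lambda>i. \<Sum>k\<in>S. c k * w k i) v = (\<Sum>k\<in>S. c k * matrix_form n M (w k) v)"
proof -
  have "matrix_form n M (\<lambda>i. \<Sum>k\<in>S. c k * w k i) v
      = (\<Sum>i<n. \<Sum>j<n. \<Sum>k\<in>S. c k * (w k i * M i j * v j))"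
    by (simp add: matrix_form_def sum_distrib_left sum_distrib_right mult.assoc)
  also have "\<dots> = (\<Sum>k\<in>S. \<Sum>i<n. \<Sum>j<n. c k * (w k i * M i j * v j))"
    by (subst (2) sum.swap, subst sum.swap) (rule refl)
  finally show ?thesis by (simp add: matrix_form_def sum_distrib_left)
qed

lemma matrix_form_add_left:
  "matrix_form n M (\<lambda>i. u i + c * w i) v = matrix_form n M u v + c * matrix_form n M w v"
  by (simp add: matrix_form_def sum.distrib sum_distrib_left algebra_simps)

lemma matrix_form_add_right:
  "matrix_form n M u (\<lambda>i. v i + c * w i) = matrix_form n M u v + c * matrix_form n M u w"
  by (simp add: matrix_form_def sum.distrib sum_distrib_left algebra_simps)

lemma matrix_form_add_matrix:
  "matrix_form n (\<lambda>i j. M i j + c * N i j) u v = matrix_form n M u v + c * matrix_form n N u v"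
  by (simp add: matrix_form_def sum.distrib sum_distrib_left algebra_simps)

lemma pos_semidef_iff:
  "pos_semidef n M \<longleftrightarrow> symmetric_matrix n M \<and> (\<forall>v. 0 \<le> matrix_form n M v v)"
  by (simp add: pos_semidef_def matrix_form_def)

lemma matrix_form_square:
  assumes "symmetric_matrix n M"
  shows "matrix_form n M (\<lambda>i. u i + c * w i) (\<lambda>i. u i + c * w i)
    = matrix_form n M u u + 2 * c * matrix_form n M u w + c^2 * matrix_form n M w w"
  unfolding matrix_form_add_left matrix_form_add_right matrix_form_commute[OF assms, of w u]
  by (simp add: algebra_simps power2_eq_square)

text \<open>
  Otherwise the form would be affine and non-constant, hence negative somewhere, on the line through
  \<open>u\<close> in the direction \<open>w\<close>.
\<close>

lemma pos_semidef_isotropic: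
  assumes "pos_semidef n M" "matrix_form n M w w = 0"
  shows "matrix_form n M u w = 0"
proof (rule ccontr)
  assume "matrix_form n M u w \<noteq> 0"
  moreover have "0 \<le> matrix_form n M u u + 2 * c * matrix_form n M u w" for c
    using matrix_form_square[of n M u c w] assms by (metis add.right_neutral mult_zero_right pos_semidef_iff)
  from this[of "(- 1 - matrix_form n M u u) / (2 * matrix_form n M u w)"]
  have "matrix_form n M u w \<noteq> 0 \<Longrightarrow> False" by (simp add: field_simps)
  ultimately show False by blast
qed

lemma pos_semidef_add_le:
  assumes "pos_semidef n M"
  shows "matrix_form n M (\<lambda>i. u i + c * w i) (\<lambda>i. u i + c * w i)
    \<le> 2 * matrix_form n M u u + 2 * c^2 * matrix_form n M w w"
proof -
  have s: "symmetric_matrix n M" and "0 \<le> matrix_form n M (\<lambda>i. u i + (- c) * w i) (\<lambda>i. u i + (- c) * w i)"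
    using assms by (simp_all only: pos_semidef_iff)
  then show ?thesis unfolding matrix_form_square[OF s] by (simp add: algebra_simps)
qed

text \<open>
  Two positive semidefinite forms are compared on the span of finitely many vectors, by induction on their
  number. If the last vector is isotropic, it contributes nothing to either form. Otherwise the other
  vectors are projected orthogonally to it with respect to the first form, which makes that form split as a
  sum, while the second form satisfies \<open>q(v' + a w) \<le> 2 q(v') + 2 a\<^sup>2 q(w)\<close>.
\<close>

lemma pos_semidef_dominated_on_family:
  fixes w :: "nat \<Rightarrow> nat \<Rightarrow> real" and m :: nat
  assumes M0: "pos_semidef n M0" and M: "pos_semidef n M"
    and ker: "\<And>v. matrix_form n M0 v v = 0 \<Longrightarrow> matrix_form n M v v = 0"
  shows "\<exists>C\<ge>0. \<forall>c. matrix_form n M (\<lambda>i. \<Sum>k<m. c k * w k i) (\<lambda>i. \<Sum>k<m. c k * w k i)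
     \<le> C * matrix_form n M0 (\<lambda>i. \<Sum>k<m. c k * w k i) (\<lambda>i. \<Sum>k<m. c k * w k i)"
proof (induction m arbitrary: w)
  case 0
  then show ?case by (auto simp: matrix_form_def)
next
  case (Suc m)
  have sym: "symmetric_matrix n M0" "symmetric_matrix n M" using M0 M by (simp_all add: pos_semidef_iff)
  let ?p = "\<lambda>v. matrix_form n M0 v v" and ?q = "\<lambda>v. matrix_form n M v v"
  have nonneg: "0 \<le> ?p v" "0 \<le> ?q v" for v using M0 M by (simp_all add: pos_semidef_iff)
  show ?case
  proof (cases "?p (w m) = 0")
    case True
    have iso: "matrix_form n M0 u (w m) = 0" "matrix_form n M u (w m) = 0" "?q (w m) = 0" for u
      using pos_semidef_isotropic[OF M0 True] pos_semidef_isotropic[OF M] ker True by blast+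
    obtain C where "0 \<le> C" "\<And>c. ?q (\<lambda>i. \<Sum>k<m. c k * w k i) \<le> C * ?p (\<lambda>i. \<Sum>k<m. c k * w k i)"
      using Suc[of w] by blast
    then show ?thesis
      by (auto simp: matrix_form_square[OF sym(1)] matrix_form_square[OF sym(2)] iso)
  next
    case False
    then have q: "0 < ?p (w m)" using nonneg(1)[of "w m"] by simp
    define r where "r k = matrix_form n M0 (w k) (w m) / ?p (w m)" for k
    define w' where "w' k i = w k i + (- r k) * w m i" for k i
    have orth: "matrix_form n M0 (w' k) (w m) = 0" for k
      using q unfolding w'_def matrix_form_add_left by (simp add: r_def)
    obtain C where C: "0 \<le> C" "\<And>c. ?q (\<lambda>i. \<Sum>k<m. c k * w' k i) \<le> C * ?p (\<lambda>i. \<Sum>k<m. c k * w' k i)"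
      using Suc[of w'] by blast
    define C' where "C' = 2 * C + 2 * ?q (w m) / ?p (w m)"
    have "?q (\<lambda>i. \<Sum>k<Suc m. c k * w k i) \<le> C' * ?p (\<lambda>i. \<Sum>k<Suc m. c k * w k i)" for c
    proof -
      define v' where "v' i = (\<Sum>k<m. c k * w' k i)" for i
      define a where "a = c m + (\<Sum>k<m. c k * r k)"
      have v: "(\<lambda>i. \<Sum>k<Suc m. c k * w k i) = (\<lambda>i. v' i + a * w m i)"
        by (simp add: fun_eq_iff v'_def w'_def a_def algebra_simps sum.distrib sum_subtractf sum_distrib_left)
      have "matrix_form n M0 v' (w m) = 0"
        unfolding v'_def matrix_form_sum_left orth by simp
      then have q0v: "?p (\<lambda>i. v' i + a * w m i) = ?p v' + a^2 * ?p (w m)"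
        by (simp add: matrix_form_square[OF sym(1)])
      have "?q (\<lambda>i. v' i + a * w m i) \<le> 2 * ?q v' + 2 * a^2 * ?q (w m)"
        by (rule pos_semidef_add_le[OF M])
      also have "\<dots> \<le> 2 * (C * ?p v') + 2 * a^2 * ?q (w m)"
        using C(2)[of c] unfolding v'_def by simp
      also have "\<dots> \<le> C' * (?p v' + a^2 * ?p (w m))"
      proof -
        have "0 \<le> 2 * ?q (w m) / ?p (w m) * ?p v'" "0 \<le> 2 * C * (a^2 * ?p (w m))"
          using nonneg C(1) by simp_all
        moreover have "C' * (?p v' + a^2 * ?p (w m)) = 2 * (C * ?p v') + 2 * a^2 * ?q (w m)
            + 2 * ?q (w m) / ?p (w m) * ?p v' + 2 * C * (a^2 * ?p (w m))"
          using q unfolding C'_def by (simp add: field_simps)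
        ultimately show ?thesis by linarith
      qed
      finally show ?thesis unfolding v q0v .
    qed
    moreover have "0 \<le> C'" using C(1) nonneg by (simp add: C'_def)
    ultimately show ?thesis by blast
  qed
qed

text \<open>
  This is the finite-dimensional fact behind the exposedness of the faces of spectrahedra: if the
  kernel of \<open>M0\<close> is contained in that of \<open>M\<close>, then \<open>M0 - e M\<close> remains positive semidefinite for small \<open>e > 0\<close>.
\<close>

lemma pos_semidef_dominated:
  assumes "pos_semidef n M0" "pos_semidef n M"
    and "\<And>v. matrix_form n M0 v v = 0 \<Longrightarrow> matrix_form n M v v = 0"
  obtains C where "0 \<le> C" "\<And>v. matrix_form n M v v \<le> C * matrix_form n M0 v v"
proof -
  define w :: "nat \<Rightarrow> nat \<Rightarrow> real" where "w k i = (if i = k then 1 else 0)" for k i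
  have "matrix_form n N (\<lambda>i. \<Sum>k<n. v k * w k i) (\<lambda>i. \<Sum>k<n. v k * w k i) = matrix_form n N v v" for N v
    unfolding matrix_form_def w_def by (intro sum.cong refl) (simp add: if_distrib cong: if_cong)
  then show ?thesis using pos_semidef_dominated_on_family[OF assms, where m = n and w = w] that by auto
qed

text \<open>
  The argument takes place in the plane of the quartics \<open>y\<^sup>4 + s z\<^sup>4 + 2 t y\<^sup>2 z\<^sup>2\<close>. These are non-negative when
  \<open>s = 0 \<le> t\<close> and when \<open>s = t\<^sup>2\<close>. Let \<open>M0 + s B + 2 t N\<close> be the matrices of a linear matrix inequality on
  this plane. The ray shows that \<open>N\<close> is positive semidefinite, and the parabola, which is tangent to the ray,
  shows that \<open>N\<close> vanishes on the kernel of \<open>M0\<close>. So the ray can be prolonged beyond \<open>t = 0\<close>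
  inside the spectrahedron, whereas \<open>y\<^sup>4 - 2 e y\<^sup>2 z\<^sup>2\<close> takes negative values.
\<close>

lemma nonneg_quartics_not_spectrahedron: "\<not> is_spectrahedron nonneg_quartics"
proof
  assume "is_spectrahedron nonneg_quartics"
  then obtain n A0 A where sym: "symmetric_matrix n A0" "\<And>m. symmetric_matrix n (A m)"
    and K: "nonneg_quartics = {x. pos_semidef n (\<lambda>i j. A0 i j + (\<Sum>m\<in>UNIV. x $ m * A m i j))}"
    unfolding is_spectrahedron_def by blast
  define L where "L x i j = (\<Sum>m\<in>UNIV. x $ m * A m i j)" for x :: quartic and i j
  define M0 where "M0 i j = A0 i j + L (monomial (0,4,0)) i j" for i j
  define B where "B = L (monomial (0,0,4))"
  define N where "N = L (monomial (0,2,2))"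
  have symL: "symmetric_matrix n (L x)" for x
    using sym(2) by (auto simp: symmetric_matrix_def L_def)
  define f where "f s t = monomial (0,4,0) + s *\<^sub>R monomial (0,0,4) + (2 * t) *\<^sub>R monomial (0,2,2)" for s t
  have eval: "quartic_eval (f s t) x = (x $ 2)^4 + s * (x $ 3)^4 + 2 * t * ((x $ 2)^2 * (x $ 3)^2)" for s t x
    by (simp add: f_def quartic_eval_monomial)
  have "(\<lambda>i j. A0 i j + L (f s t) i j) = (\<lambda>i j. (M0 i j + s * B i j) + (2 * t) * N i j)" for s t
    by (simp add: fun_eq_iff L_def f_def M0_def B_def N_def sum.distrib sum_distrib_left algebra_simps)
  then have f: "f s t \<in> nonneg_quartics \<longleftrightarrow> pos_semidef n (\<lambda>i j. (M0 i j + s * B i j) + (2 * t) * N i j)" for s t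
    unfolding K L_def by simp
  have form: "0 \<le> matrix_form n M0 v v + s * matrix_form n B v v + 2 * t * matrix_form n N v v"
    if "f s t \<in> nonneg_quartics" for s t v
    using that unfolding f pos_semidef_iff matrix_form_add_matrix by blast
  have mem1: "f 0 t \<in> nonneg_quartics" if "0 \<le> t" for t
    using that by (simp add: nonneg_quartics_iff eval)
  have mem2: "f (t^2) t \<in> nonneg_quartics" for t
  proof -
    have "quartic_eval (f (t^2) t) x = ((x $ 2)^2 + t * (x $ 3)^2)^2" for x
      by (simp add: eval algebra_simps power2_eq_square power4_eq_xxxx)
    then show ?thesis by (simp add: nonneg_quartics_iff)
  qed
  have M0: "pos_semidef n M0" using f[of 0 0] mem1[of 0] by simp
  have N: "pos_semidef n N"
    unfolding pos_semidef_iff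
  proof (intro conjI allI)
    show "symmetric_matrix n N" unfolding N_def by (rule symL)
    fix v show "0 \<le> matrix_form n N v v"
    proof (rule ccontr)
      assume neg: "\<not> ?thesis"
      let ?t = "(- 1 - matrix_form n M0 v v) / (2 * matrix_form n N v v)"
      have "0 \<le> matrix_form n M0 v v" using M0 by (simp add: pos_semidef_iff)
      then have "0 \<le> ?t" using neg by (intro divide_nonpos_neg) auto
      from form[OF mem1[OF this], of v] show False using neg by (simp add: field_simps)
    qed
  qed
  have ker: "matrix_form n N v v = 0" if "matrix_form n M0 v v = 0" for v
    using linear_coeff_eq_0[of "2 * matrix_form n N v v" "matrix_form n B v v" 0 0]
      form[OF mem2, of v] that by (simp add: algebra_simps)
  obtain C where C: "0 \<le> C" "\<And>v. matrix_form n N v v \<le> C * matrix_form n M0 v v"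
    using pos_semidef_dominated[OF M0 N ker] by blast
  define e where "e = 1 / (2 * C + 1)"
  have e: "0 < e" "2 * e * C \<le> 1" using C(1) by (simp_all add: e_def)
  have "pos_semidef n (\<lambda>i j. (M0 i j + 0 * B i j) + (2 * (- e)) * N i j)"
    unfolding pos_semidef_iff matrix_form_add_matrix
  proof (intro conjI allI)
    show "symmetric_matrix n (\<lambda>i j. M0 i j + 0 * B i j + 2 * - e * N i j)"
      using sym(1) symL by (auto simp: symmetric_matrix_def M0_def N_def)
    fix v
    have "2 * e * matrix_form n N v v \<le> 2 * e * (C * matrix_form n M0 v v)"
      using C(2) e by (intro mult_left_mono) auto
    also have "\<dots> = (2 * e * C) * matrix_form n M0 v v" by simp
    also have "\<dots> \<le> 1 * matrix_form n M0 v v"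
      using M0 e by (intro mult_right_mono) (auto simp: pos_semidef_iff)
    finally show "0 \<le> matrix_form n M0 v v + 0 * matrix_form n B v v + 2 * - e * matrix_form n N v v" by simp
  qed
  then have "f 0 (- e) \<in> nonneg_quartics" using f by blast
  then have "0 \<le> quartic_eval (f 0 (- e)) (vector [0, 1, sqrt (1 / e)])"
    by (simp add: nonneg_quartics_iff)
  then show False using e by (simp add: eval vector_3)
qed

theorem theorem6p2:
  shows "\<not> is_spectrahedron nonneg_quartics
    \<and> (\<forall>F. is_facet nonneg_quartics F \<longrightarrow> aff_dim F = 12)
    \<and> (\<forall>F G. is_facet nonneg_quartics F \<and> is_facet nonneg_quartics G \<and> F \<noteq> G \<longrightarrow>
          (F \<inter> G) exposed_face_of nonneg_quartics \<and> aff_dim (F \<inter> G) = 9)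
    \<and> (\<exists>F. maximal_nonexposed_face nonneg_quartics F \<and> aff_dim F = 9)"
  using nonneg_quartics_not_spectrahedron aff_dim_facet facet_Int_facet
    maximal_nonexposed_flat_face aff_dim_flat_face
  by blast

end
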